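(* Let $M$ be a regular abelian monoid. Then $M$ is a refinement monoid if and only if the semilattice $\Lambda(M)$ of idempotents of $M$ is a distributive semilattice and $M$ satisfies the Mayer-Vietoris property.
   Context: All monoids are abelian, written additively with identity $0$. The algebraic preorder on $M$ is: $x\leq y$ iff $x+z=y$ for some $z\in M$. $M$ is regular if $2x\leq x$ for all $x\in M$ (equivalently, for each $x$ there is $y$ with $x+y+x=x$). $M$ is a refinement monoid if whenever $x_1+x_2=y_1+y_2$ in $M$, there are $z_{ij}\in M$ ($i,j\in\{1,2\}$) with $x_i=z_{i1}+z_{i2}$ and $y_j=z_{1j}+z_{2j}$ for all $i,j$. A semilattice is an abelian monoid in which $2x=x$ for all $x$ (equivalently, a join-semilattice with least element $0$ and $+=\vee$); it is distributive if it is a refinement monoid (equivalently, whenever $x\leq y_1+y_2$ there are $x_i\leq y_i$ with $x=x_1+x_2$). $\Lambda(M)=\{e\in M\mid 2e=e\}$ is a submonoid of $M$ and a semilattice. For $e\in\Lambda(M)$, $G_M[e]=\{x\in M\mid e\leq x\leq e\}$, an abelian group under $+$ with identity $e$; a regular $M$ is the disjoint union of the groups $G_M[e]$. Mayer-Vietoris property of a regular abelian monoid $M$: for all idempotents $e,f\in\Lambda(M)$, (a) $G_M[e]+G_M[f]=G_M[e+f]$; and (b) whenever $u\in G_M[e]$ and $v\in G_M[f]$ satisfy $u+f=v+e$, there exists $w\in M$ such that $u=w+e$ and $v=w+f$. *)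

theory Defs
  imports "HOL-Algebra.Coset"
begin

text \<open>
  Abelian monoids are HOL-Algebra's commutative monoids, hence written multiplicatively:
  \<open>\<otimes>\<close> and \<open>\<one>\<close> stand for the additive \<open>+\<close> and \<open>0\<close>, and \<open>x \<otimes> x\<close> for \<open>2x\<close>.
\<close>

definition alg_le :: "('a, 'b) monoid_scheme \<Rightarrow> 'a \<Rightarrow> 'a \<Rightarrow> bool" (infix \<open>\<preceq>\<index>\<close> 50)
  where "x \<preceq>\<^bsub>M\<^esub> y \<longleftrightarrow> (\<exists>z\<in>carrier M. x \<otimes>\<^bsub>M\<^esub> z = y)"

locale regular_comm_monoid = comm_monoid M for M (structure) +
  assumes regular: "x \<in> carrier M \<Longrightarrow> x \<otimes> x \<preceq> x"

locale refinement_monoid = comm_monoid M for M (structure) +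
  assumes refinement:
    "\<lbrakk>x1 \<in> carrier M; x2 \<in> carrier M; y1 \<in> carrier M; y2 \<in> carrier M; x1 \<otimes> x2 = y1 \<otimes> y2\<rbrakk>
      \<Longrightarrow> \<exists>z11\<in>carrier M. \<exists>z12\<in>carrier M. \<exists>z21\<in>carrier M. \<exists>z22\<in>carrier M.
            x1 = z11 \<otimes> z12 \<and> x2 = z21 \<otimes> z22 \<and> y1 = z11 \<otimes> z21 \<and> y2 = z12 \<otimes> z22"

locale semilattice_monoid = comm_monoid M for M (structure) +
  assumes idem: "x \<in> carrier M \<Longrightarrow> x \<otimes> x = x"

locale distributive_semilattice = semilattice_monoid M + refinement_monoid M for M (structure)

definition idempotents :: "('a, 'b) monoid_scheme \<Rightarrow> 'a set"
  where "idempotents M = {e \<in> carrier M. e \<otimes>\<^bsub>M\<^esub> e = e}"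

definition idempotent_semilattice :: "('a, 'b) monoid_scheme \<Rightarrow> ('a, 'b) monoid_scheme"
  where "idempotent_semilattice M = M\<lparr>carrier := idempotents M\<rparr>"

text \<open>The underlying set of the group \<open>G\<^sub>M[e]\<close>.\<close>

definition idem_class :: "('a, 'b) monoid_scheme \<Rightarrow> 'a \<Rightarrow> 'a set"
  where "idem_class M e = {x \<in> carrier M. e \<preceq>\<^bsub>M\<^esub> x \<and> x \<preceq>\<^bsub>M\<^esub> e}"

definition mayer_vietoris :: "('a, 'b) monoid_scheme \<Rightarrow> bool"
  where "mayer_vietoris M \<longleftrightarrow>
    (\<forall>e\<in>idempotents M. \<forall>f\<in>idempotents M.
      idem_class M e <#>\<^bsub>M\<^esub> idem_class M f = idem_class M (e \<otimes>\<^bsub>M\<^esub> f) \<and>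
      (\<forall>u\<in>idem_class M e. \<forall>v\<in>idem_class M f.
        u \<otimes>\<^bsub>M\<^esub> f = v \<otimes>\<^bsub>M\<^esub> e \<longrightarrow>
        (\<exists>w\<in>carrier M. u = w \<otimes>\<^bsub>M\<^esub> e \<and> v = w \<otimes>\<^bsub>M\<^esub> f)))"

lemma (in comm_monoid) semilattice_idempotents:
  "semilattice_monoid (idempotent_semilattice G)"
proof -
  have "(x \<otimes> y) \<otimes> (x \<otimes> y) = x \<otimes> y"
    if "x \<in> carrier G" "x \<otimes> x = x" "y \<in> carrier G" "y \<otimes> y = y" for x y
  proof -
    have "(x \<otimes> y) \<otimes> (x \<otimes> y) = (x \<otimes> x) \<otimes> (y \<otimes> y)"
      using that(1,3) by (simp add: m_ac)
    with that show ?thesis by simp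
  qed
  then show ?thesis
    by unfold_locales (auto simp: idempotent_semilattice_def idempotents_def m_ac)
qed

end

theory Submission
  imports Defs
begin

text \<open>
  A regular abelian monoid is a semilattice of the groups \<open>G[e]\<close>; write \<open>\<epsilon> x\<close> for the idempotent
  whose group contains \<open>x\<close>, a homomorphism onto \<open>\<Lambda>(M)\<close>. In additive notation:

  If \<open>M\<close> has refinement, applying \<open>\<epsilon>\<close> to refinements shows that \<open>\<Lambda>(M)\<close> is distributive, and the
  Mayer-Vietoris property is obtained by refining \<open>x + y = e + f\<close> for (a) and \<open>u + f = v + e\<close>
  for (b); if \<open>u = a + b\<close>, \<open>f = c + d\<close>, \<open>v = a + c\<close>, \<open>e = b + d\<close>, then \<open>w = a - d\<close> works.

  Conversely, let \<open>x1 + x2 = y1 + y2\<close>. Refine \<open>\<epsilon> x1 + \<epsilon> x2 = \<epsilon> y1 + \<epsilon> y2\<close> in \<open>\<Lambda>(M)\<close> and lift along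
  (a) to elements \<open>a\<^sub>i\<^sub>j\<close> whose row sums are the \<open>x\<^sub>i\<close>. By (b), the column sums differ from \<open>y1\<close> and \<open>y2\<close>
  by \<open>w\<close> and \<open>- w\<close> for a single \<open>w\<close> with \<open>\<epsilon> w\<close> below \<open>\<epsilon> y1\<close> and \<open>\<epsilon> y2\<close>. Since
  \<open>\<epsilon> w \<le> \<epsilon> x1 + \<epsilon> x2\<close>, distributivity and (a) split \<open>w = w1 + w2\<close> with \<open>\<epsilon> w\<^sub>i \<le> \<epsilon> x\<^sub>i\<close>, and adding
  \<open>w\<^sub>i\<close> to \<open>a\<^sub>i\<^sub>1\<close> and \<open>- w\<^sub>i\<close> to \<open>a\<^sub>i\<^sub>2\<close> corrects the columns without changing the rows.
\<close>

context regular_comm_monoid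
begin

section \<open>Group inverses and the support homomorphism\<close>

definition pinv :: "'a \<Rightarrow> 'a"
  where "pinv x = (SOME y. y \<in> carrier M \<and> x \<otimes> y \<otimes> x = x \<and> y \<otimes> x \<otimes> y = y)"

text \<open>The map \<epsilon> of the overview: the identity of the group containing
  \<open>x\<close>.\<close>

definition supp :: "'a \<Rightarrow> 'a"
  where "supp x = x \<otimes> pinv x"

text \<open>Regularity gives only \<open>x \<otimes> z \<otimes> x = x\<close>; passing to
  \<open>z \<otimes> x \<otimes> z\<close> secures the second equation as well, on which uniqueness
  rests.\<close>

lemma pinv_exists:
  assumes x: "x \<in> carrier M"
  shows "\<exists>y. y \<in> carrier M \<and> x \<otimes> y \<otimes> x = x \<and> y \<otimes> x \<otimes> y = y"
proof -
  from regular[OF x] obtain z where z: "z \<in> carrier M" "x \<otimes> x \<otimes> z = x"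
    by (auto simp: alg_le_def)
  have xzx: "x \<otimes> (z \<otimes> x) = x"
    using x z by (simp add: m_ac)
  have "x \<otimes> (z \<otimes> x \<otimes> z) \<otimes> x = x \<otimes> (z \<otimes> (x \<otimes> (z \<otimes> x)))"
    using x z(1) by (simp add: m_ac)
  then have 1: "x \<otimes> (z \<otimes> x \<otimes> z) \<otimes> x = x"
    by (simp add: xzx)
  have "(z \<otimes> x \<otimes> z) \<otimes> x \<otimes> (z \<otimes> x \<otimes> z) = z \<otimes> (x \<otimes> (z \<otimes> (x \<otimes> (z \<otimes> x)))) \<otimes> z"
    using x z(1) by (simp add: m_ac)
  then have 2: "(z \<otimes> x \<otimes> z) \<otimes> x \<otimes> (z \<otimes> x \<otimes> z) = z \<otimes> x \<otimes> z"
    by (simp add: xzx)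
  show ?thesis
    using 1 2 x z(1) by blast
qed

lemma
  assumes "x \<in> carrier M"
  shows pinv_closed [simp]: "pinv x \<in> carrier M"
    and pinv_regular: "x \<otimes> pinv x \<otimes> x = x"
    and pinv_reflexive: "pinv x \<otimes> x \<otimes> pinv x = pinv x"
  using someI_ex[OF pinv_exists[OF assms]] by (auto simp: pinv_def)

text \<open>By commutativity, two inverses \<open>y\<close> and \<open>?z\<close> both collapse to
  \<open>y \<otimes> x \<otimes> ?z\<close>. This frees \<open>pinv\<close> from its choice: to
  identify an inverse, it suffices to check the two equations.\<close>

lemma pinv_unique:
  assumes c: "x \<in> carrier M" "y \<in> carrier M"
    and y: "x \<otimes> y \<otimes> x = x" "y \<otimes> x \<otimes> y = y"
  shows "pinv x = y"
proof -
  let ?z = "pinv x"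
  have "y = y \<otimes> (x \<otimes> ?z \<otimes> x) \<otimes> y"
    using c y by (simp add: pinv_regular)
  also have "\<dots> = ?z \<otimes> (x \<otimes> y \<otimes> x) \<otimes> y"
    using c by (simp add: m_ac)
  also have "\<dots> = y \<otimes> x \<otimes> ?z"
    using c y by (simp add: m_ac)
  also have "\<dots> = y \<otimes> (x \<otimes> ?z \<otimes> x) \<otimes> ?z"
    using c by (simp add: pinv_regular)
  also have "\<dots> = ?z \<otimes> (x \<otimes> y \<otimes> x) \<otimes> ?z"
    using c by (simp add: m_ac)
  also have "\<dots> = ?z"
    using c y by (simp add: pinv_reflexive)
  finally show ?thesis ..
qed

lemma pinv_mult:
  assumes c: "x \<in> carrier M" "y \<in> carrier M"
  shows "pinv (x \<otimes> y) = pinv x \<otimes> pinv y"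
proof (rule pinv_unique)
  have "x \<otimes> y \<otimes> (pinv x \<otimes> pinv y) \<otimes> (x \<otimes> y) = (x \<otimes> pinv x \<otimes> x) \<otimes> (y \<otimes> pinv y \<otimes> y)"
    using c by (simp add: m_ac)
  then show "x \<otimes> y \<otimes> (pinv x \<otimes> pinv y) \<otimes> (x \<otimes> y) = x \<otimes> y"
    using c by (simp add: pinv_regular)
  have "pinv x \<otimes> pinv y \<otimes> (x \<otimes> y) \<otimes> (pinv x \<otimes> pinv y)
      = (pinv x \<otimes> x \<otimes> pinv x) \<otimes> (pinv y \<otimes> y \<otimes> pinv y)"
    using c by (simp add: m_ac)
  then show "pinv x \<otimes> pinv y \<otimes> (x \<otimes> y) \<otimes> (pinv x \<otimes> pinv y) = pinv x \<otimes> pinv y"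
    using c by (simp add: pinv_reflexive)
qed (use c in auto)

lemma supp_closed [simp]: "x \<in> carrier M \<Longrightarrow> supp x \<in> carrier M"
  by (simp add: supp_def)

lemma supp_mult:
  "\<lbrakk>x \<in> carrier M; y \<in> carrier M\<rbrakk> \<Longrightarrow> supp (x \<otimes> y) = supp x \<otimes> supp y"
  by (simp add: supp_def pinv_mult m_ac)

lemma mult_pinv: "x \<in> carrier M \<Longrightarrow> x \<otimes> pinv x = supp x"
  by (simp add: supp_def)

lemma supp_pinv [simp]:
  assumes "x \<in> carrier M"
  shows "supp (pinv x) = supp x"
proof -
  have "pinv (pinv x) = x"
    using assms by (intro pinv_unique) (auto simp: pinv_regular pinv_reflexive)
  then show ?thesis
    using assms by (simp add: supp_def m_comm)
qed

lemma idempotentsD [simp]: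
  assumes "e \<in> idempotents M"
  shows "e \<in> carrier M" "e \<otimes> e = e" "supp e = e"
proof -
  show *: "e \<in> carrier M" "e \<otimes> e = e"
    using assms by (auto simp: idempotents_def)
  then have "pinv e = e"
    by (intro pinv_unique) auto
  with * show "supp e = e"
    by (simp add: supp_def)
qed

lemma supp_idempotent [simp]:
  assumes "x \<in> carrier M"
  shows "supp x \<in> idempotents M"
proof -
  have "supp x \<otimes> supp x = (x \<otimes> pinv x \<otimes> x) \<otimes> pinv x"
    using assms by (simp add: supp_def m_ac)
  also have "\<dots> = supp x"
    using assms by (simp add: pinv_regular supp_def)
  finally show ?thesis
    unfolding idempotents_def using supp_closed[OF assms] by blast
qed

lemma mult_supp:
  assumes "x \<in> carrier M"
  shows "x \<otimes> supp x = x"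
proof -
  have "x \<otimes> supp x = x \<otimes> pinv x \<otimes> x"
    using assms by (simp add: supp_def m_ac)
  with assms show ?thesis by (simp add: pinv_regular)
qed

text \<open>Absorption is inherited from the support because
  \<open>x = x \<otimes> supp x\<close>.\<close>

lemma mult_absorb:
  assumes "x \<in> carrier M" "h \<in> carrier M" "h \<otimes> supp x = supp x"
  shows "x \<otimes> h = x"
proof -
  have "x \<otimes> h = (x \<otimes> supp x) \<otimes> h"
    using assms(1) by (simp add: mult_supp)
  also have "\<dots> = x \<otimes> (h \<otimes> supp x)"
    using assms(1,2) by (simp add: m_ac)
  finally show ?thesis
    using assms by (simp add: mult_supp)
qed

lemma idempotents_mult [simp]:
  assumes "e \<in> idempotents M" "f \<in> idempotents M"
  shows "e \<otimes> f \<in> idempotents M"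
proof -
  have "supp (e \<otimes> f) = e \<otimes> f"
    using assms by (simp add: supp_mult)
  then show ?thesis
    using supp_idempotent[of "e \<otimes> f"] assms by simp
qed

lemma idempotent_absorb_mult:
  assumes "e \<in> idempotents M" "f \<in> carrier M"
  shows "e \<otimes> (e \<otimes> f) = e \<otimes> f"
  using assms by (simp flip: m_assoc)

text \<open>Under \<open>supp\<close> the two inequalities become mutual absorption of the
  idempotents \<open>e\<close> and \<open>supp x\<close>, which forces equality; conversely,
  \<open>x\<close> and \<open>pinv x\<close> witness the inequalities.\<close>

lemma idem_class_eq:
  assumes e: "e \<in> idempotents M"
  shows "idem_class M e = {x \<in> carrier M. supp x = e}"
proof -
  have "supp x = e" if x: "x \<in> carrier M" and le: "e \<preceq> x" "x \<preceq> e" for x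
  proof -
    from le obtain y z where y: "y \<in> carrier M" "e \<otimes> y = x" and z: "z \<in> carrier M" "x \<otimes> z = e"
      by (auto simp: alg_le_def)
    have sx: "supp x = e \<otimes> supp y"
      using y e supp_mult by fastforce
    have se: "e = supp x \<otimes> supp z"
      using z x e supp_mult by fastforce
    have "supp x = e \<otimes> supp x"
      using sx e y by (simp add: idempotent_absorb_mult)
    moreover have "e = supp x \<otimes> e"
      using se x z by (metis idempotent_absorb_mult supp_closed supp_idempotent)
    ultimately show ?thesis
      using x e by (metis idempotentsD(1) m_comm supp_closed)
  qed
  moreover have "supp x \<preceq> x \<and> x \<preceq> supp x" if "x \<in> carrier M" for x
    using that unfolding alg_le_def
    by (metis m_comm mult_pinv mult_supp pinv_closed supp_closed)
  ultimately show ?thesis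
    by (auto simp: idem_class_def)
qed

section \<open>Refinement implies Mayer-Vietoris and distributivity\<close>

lemma mayer_vietoris_if_refinement:
  assumes "refinement_monoid M"
  shows "mayer_vietoris M"
proof -
  interpret refinement_monoid M by fact
  have "idem_class M e <#> idem_class M f = idem_class M (e \<otimes> f)"
    if e: "e \<in> idempotents M" and f: "f \<in> idempotents M" for e f
  proof
    show "idem_class M e <#> idem_class M f \<subseteq> idem_class M (e \<otimes> f)"
      using e f by (auto simp: idem_class_eq set_mult_def supp_mult)
    show "idem_class M (e \<otimes> f) \<subseteq> idem_class M e <#> idem_class M f"
    proof
      fix x assume "x \<in> idem_class M (e \<otimes> f)"
      then have x: "x \<in> carrier M" "supp x = e \<otimes> f"
        using e f by (auto simp: idem_class_eq)
      have "x \<otimes> pinv x = e \<otimes> f"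
        using x by (simp add: mult_pinv)
      then obtain a b c d where abcd: "a \<in> carrier M" "b \<in> carrier M" "c \<in> carrier M" "d \<in> carrier M"
        and xab: "x = a \<otimes> b" and eac: "e = a \<otimes> c" and fbd: "f = b \<otimes> d"
        using refinement[of x "pinv x" e f] x e f by auto
      have "supp e = supp a \<otimes> supp c" "supp f = supp b \<otimes> supp d"
        using abcd eac fbd by (simp_all add: supp_mult)
      \<comment> \<open>The supports of \<open>a\<close> and \<open>b\<close> may be too small; the
        factors \<open>e\<close> and \<open>f\<close> raise them to the right values and change the
        product only by \<open>supp x\<close>.\<close>
      then have "supp (a \<otimes> e) = e" "supp (b \<otimes> f) = f"
        using abcd e f by (simp_all add: supp_mult idempotent_absorb_mult)
      moreover have "(a \<otimes> e) \<otimes> (b \<otimes> f) = x"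
      proof -
        have "(a \<otimes> e) \<otimes> (b \<otimes> f) = x \<otimes> supp x"
          unfolding x(2) unfolding xab using abcd e f by (simp add: m_ac)
        with x(1) show ?thesis by (simp add: mult_supp)
      qed
      ultimately show "x \<in> idem_class M e <#> idem_class M f"
        unfolding set_mult_def idem_class_eq[OF e] idem_class_eq[OF f]
        using abcd e f idempotentsD(1) m_closed by blast
    qed
  qed
  moreover have "\<exists>w\<in>carrier M. u = w \<otimes> e \<and> v = w \<otimes> f"
    if e: "e \<in> idempotents M" and f: "f \<in> idempotents M"
      and u: "u \<in> idem_class M e" and v: "v \<in> idem_class M f" and eq: "u \<otimes> f = v \<otimes> e" for e f u v
  proof -
    have uv: "u \<in> carrier M" "v \<in> carrier M" "supp u = e" "supp v = f"
      using e f u v by (auto simp: idem_class_eq)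
    obtain a b c d where abcd: "a \<in> carrier M" "b \<in> carrier M" "c \<in> carrier M" "d \<in> carrier M"
      and abcd_eq: "u = a \<otimes> b" "f = c \<otimes> d" "v = a \<otimes> c" "e = b \<otimes> d"
      using refinement[of u f v e] uv e f eq by auto
    have "supp e = supp d \<otimes> supp b" "supp f = supp d \<otimes> supp c"
      using abcd abcd_eq by (simp_all add: supp_mult m_comm)
    \<comment> \<open>\<open>d\<close> divides both \<open>e\<close> and \<open>f\<close>, so both
      absorb its support. Hence the factor \<open>supp d\<close> left over by \<open>d\<close> and
      \<open>pinv d\<close> in the gluing below disappears.\<close>
    then have "supp d \<otimes> e = e" "supp d \<otimes> f = f"
      using e f abcd by (simp_all add: idempotent_absorb_mult)
    then have absorb: "u \<otimes> supp d = u" "v \<otimes> supp d = v"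
      using uv abcd by (simp_all add: mult_absorb)
    have "a \<otimes> pinv d \<otimes> e = u \<otimes> supp d" "a \<otimes> pinv d \<otimes> f = v \<otimes> supp d"
      unfolding abcd_eq supp_def using abcd by (simp_all add: m_ac)
    with absorb abcd show ?thesis
      by (intro bexI[of _ "a \<otimes> pinv d"]) auto
  qed
  ultimately show ?thesis
    by (simp add: mayer_vietoris_def)
qed

lemma distributive_idempotents_if_refinement:
  assumes "refinement_monoid M"
  shows "distributive_semilattice (idempotent_semilattice M)"
proof -
  interpret refinement_monoid M by fact
  interpret L: semilattice_monoid "idempotent_semilattice M"
    by (rule semilattice_idempotents)
  have "\<exists>z11\<in>idempotents M. \<exists>z12\<in>idempotents M. \<exists>z21\<in>idempotents M. \<exists>z22\<in>idempotents M.
      x1 = z11 \<otimes> z12 \<and> x2 = z21 \<otimes> z22 \<and> y1 = z11 \<otimes> z21 \<and> y2 = z12 \<otimes> z22"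
    if id: "x1 \<in> idempotents M" "x2 \<in> idempotents M" "y1 \<in> idempotents M" "y2 \<in> idempotents M"
      and eq: "x1 \<otimes> x2 = y1 \<otimes> y2" for x1 x2 y1 y2
  proof -
    obtain a b c d where abcd: "a \<in> carrier M" "b \<in> carrier M" "c \<in> carrier M" "d \<in> carrier M"
      and abcd_eq: "x1 = a \<otimes> b" "x2 = c \<otimes> d" "y1 = a \<otimes> c" "y2 = b \<otimes> d"
      using refinement[of x1 x2 y1 y2] id eq by auto
    have "supp x1 = supp a \<otimes> supp b" "supp x2 = supp c \<otimes> supp d"
      "supp y1 = supp a \<otimes> supp c" "supp y2 = supp b \<otimes> supp d"
      using abcd by (simp_all add: abcd_eq supp_mult)
    with id abcd show ?thesis
      by (metis idempotentsD(3) supp_idempotent)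
  qed
  then show ?thesis
    by unfold_locales (simp add: idempotent_semilattice_def)
qed

section \<open>Distributivity and Mayer-Vietoris imply refinement\<close>

context
  assumes dist: "distributive_semilattice (idempotent_semilattice M)"
    and mv: "mayer_vietoris M"
begin

lemma idempotent_refinement:
  assumes "x1 \<in> idempotents M" "x2 \<in> idempotents M" "y1 \<in> idempotents M" "y2 \<in> idempotents M"
    and "x1 \<otimes> x2 = y1 \<otimes> y2"
  obtains a b c d where "a \<in> idempotents M" "b \<in> idempotents M" "c \<in> idempotents M" "d \<in> idempotents M"
    "x1 = a \<otimes> b" "x2 = c \<otimes> d" "y1 = a \<otimes> c" "y2 = b \<otimes> d"
proof -
  interpret L: distributive_semilattice "idempotent_semilattice M"
    by (rule dist)
  show ?thesis
    using L.refinement[of x1 x2 y1 y2] assms that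
    by (auto simp: idempotent_semilattice_def)
qed

text \<open>The order form of distributivity, with \<le> expressed as absorption: the equation
  \<open>le\<close> is itself refined, and the row of \<open>h\<close> gives the two parts.\<close>

lemma idempotent_decomposition:
  assumes h: "h \<in> idempotents M" and e: "e1 \<in> idempotents M" "e2 \<in> idempotents M"
    and le: "h \<otimes> (e1 \<otimes> e2) = e1 \<otimes> e2"
  obtains h1 h2 where "h1 \<in> idempotents M" "h2 \<in> idempotents M" "h = h1 \<otimes> h2"
    "h1 \<otimes> e1 = e1" "h2 \<otimes> e2 = e2"
proof -
  obtain a b c d where abcd: "a \<in> idempotents M" "b \<in> idempotents M" "c \<in> idempotents M" "d \<in> idempotents M"
    and abcd_eq: "h = a \<otimes> b" "e1 \<otimes> e2 = c \<otimes> d" "e1 = a \<otimes> c" "e2 = b \<otimes> d"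
    by (rule idempotent_refinement[of h "e1 \<otimes> e2" e1 e2]) (use h e le in auto)
  show ?thesis
    using that[of a b] abcd abcd_eq by (simp add: idempotent_absorb_mult)
qed

lemma supp_decomposition:
  assumes "x \<in> carrier M" "e \<in> idempotents M" "f \<in> idempotents M" "supp x = e \<otimes> f"
  obtains a b where "a \<in> carrier M" "b \<in> carrier M" "supp a = e" "supp b = f" "x = a \<otimes> b"
proof -
  have "x \<in> idem_class M e <#> idem_class M f"
    using assms mv by (simp add: mayer_vietoris_def idem_class_eq)
  with assms that show ?thesis
    by (auto simp: idem_class_eq set_mult_def)
qed

lemma supp_gluing:
  assumes "u \<in> carrier M" "v \<in> carrier M" "u \<otimes> supp v = v \<otimes> supp u"
  obtains w where "w \<in> carrier M" "u = w \<otimes> supp u" "v = w \<otimes> supp v"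
  using mv assms that by (force simp: mayer_vietoris_def idem_class_eq)

lemma refinement_if_mayer_vietoris: "refinement_monoid M"
proof unfold_locales
  fix x1 x2 y1 y2
  assume x: "x1 \<in> carrier M" "x2 \<in> carrier M" and y: "y1 \<in> carrier M" "y2 \<in> carrier M"
    and eq: "x1 \<otimes> x2 = y1 \<otimes> y2"
  have supp_eq: "supp x1 \<otimes> supp x2 = supp y1 \<otimes> supp y2"
    using x y eq by (metis supp_mult)
  obtain e11 e12 e21 e22 where e: "e11 \<in> idempotents M" "e12 \<in> idempotents M"
      "e21 \<in> idempotents M" "e22 \<in> idempotents M"
    and e_eq: "supp x1 = e11 \<otimes> e12" "supp x2 = e21 \<otimes> e22" "supp y1 = e11 \<otimes> e21" "supp y2 = e12 \<otimes> e22"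
    by (rule idempotent_refinement[of "supp x1" "supp x2" "supp y1" "supp y2"]) (use x y supp_eq in auto)
  obtain a11 a12 where a1: "a11 \<in> carrier M" "a12 \<in> carrier M" "supp a11 = e11" "supp a12 = e12"
    "x1 = a11 \<otimes> a12"
    using supp_decomposition[of x1 e11 e12] x e e_eq by metis
  obtain a21 a22 where a2: "a21 \<in> carrier M" "a22 \<in> carrier M" "supp a21 = e21" "supp a22 = e22"
    "x2 = a21 \<otimes> a22"
    using supp_decomposition[of x2 e21 e22] x e e_eq by metis
  \<comment> \<open>The column products: their supports and their total are right, but they need not
    equal \<open>y1\<close> and \<open>y2\<close>.\<close>
  define p q where "p = a11 \<otimes> a21" and "q = a12 \<otimes> a22"
  have p: "p \<in> carrier M" "supp p = supp y1" and q: "q \<in> carrier M" "supp q = supp y2"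
    using a1 a2 e_eq by (auto simp: p_def q_def supp_mult)
  have pq: "p \<otimes> q = y1 \<otimes> y2"
    using a1 a2 unfolding p_def q_def eq[symmetric] by (simp add: m_ac)
  \<comment> \<open>The column errors, taken with opposite signs so that they agree on the overlap
    and can be glued.\<close>
  define u v where "u = y1 \<otimes> pinv p" and "v = q \<otimes> pinv y2"
  have u: "u \<in> carrier M" "supp u = supp y1" and v: "v \<in> carrier M" "supp v = supp y2"
    using y p q by (auto simp: u_def v_def supp_mult)
  \<comment> \<open>In additive notation, both sides are \<open>y1 + y2 - p - y2 = p + q - p - y2\<close>.\<close>
  have "u \<otimes> supp v = y1 \<otimes> y2 \<otimes> (pinv p \<otimes> pinv y2)"
    using y p unfolding v by (simp add: u_def supp_def m_ac)
  also have "\<dots> = v \<otimes> supp p"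
    using y p(1) q(1) unfolding pq[symmetric] by (simp add: v_def supp_def m_ac)
  also have "\<dots> = v \<otimes> supp u"
    by (simp add: p u)
  finally obtain w where w: "w \<in> carrier M" "u = w \<otimes> supp u" "v = w \<otimes> supp v"
    using u v supp_gluing by metis
  \<comment> \<open>Gluing puts \<open>supp w\<close> below the supports of both columns, hence
    below their join, which is also the join of the row supports.\<close>
  have "supp u = supp w \<otimes> supp u" "supp v = supp w \<otimes> supp v"
    using w u v y by (metis idempotentsD(3) supp_closed supp_idempotent supp_mult)+
  then have w_le: "supp w \<otimes> supp y1 = supp y1" "supp w \<otimes> supp y2 = supp y2"
    unfolding u v by auto
  have "supp w \<otimes> (supp x1 \<otimes> supp x2) = supp x1 \<otimes> supp x2"
    unfolding supp_eq using w y w_le(1) by (simp flip: m_assoc)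
  then obtain h1 h2 where h: "h1 \<in> idempotents M" "h2 \<in> idempotents M" "supp w = h1 \<otimes> h2"
    "h1 \<otimes> supp x1 = supp x1" "h2 \<otimes> supp x2 = supp x2"
    using idempotent_decomposition[of "supp w" "supp x1" "supp x2"] w x supp_idempotent by metis
  obtain w1 w2 where w12: "w1 \<in> carrier M" "w2 \<in> carrier M" "supp w1 = h1" "supp w2 = h2" "w = w1 \<otimes> w2"
    using supp_decomposition[of w h1 h2] w h by metis
  \<comment> \<open>In row \<open>i\<close> the correction cancels up to its support
    \<open>h\<^sub>i\<close>, which the row absorbs.\<close>
  have "a11 \<otimes> w1 \<otimes> (a12 \<otimes> pinv w1) = x1 \<otimes> h1" "a21 \<otimes> w2 \<otimes> (a22 \<otimes> pinv w2) = x2 \<otimes> h2"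
    unfolding a1 a2 w12(3,4)[symmetric] supp_def using a1(1,2) a2(1,2) w12(1,2)
    by (simp_all add: m_ac)
  then have rows: "x1 = a11 \<otimes> w1 \<otimes> (a12 \<otimes> pinv w1)" "x2 = a21 \<otimes> w2 \<otimes> (a22 \<otimes> pinv w2)"
    using h x by (simp_all add: mult_absorb)
  have "a11 \<otimes> w1 \<otimes> (a21 \<otimes> w2) = p \<otimes> w"
    unfolding p_def w12(5) using a1(1,2) a2(1,2) w12(1,2) by (simp add: m_ac)
  \<comment> \<open>Inserting \<open>supp p\<close>, which equals \<open>supp u\<close>, turns
    \<open>w\<close> into \<open>u = y1 \<otimes> pinv p\<close>.\<close>
  also have "\<dots> = (p \<otimes> supp p) \<otimes> w"
    using p(1) by (simp add: mult_supp)
  also have "\<dots> = p \<otimes> (w \<otimes> supp u)"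
    unfolding p(2) u(2) using p(1) w(1) y by (simp add: m_ac)
  also have "\<dots> = y1 \<otimes> supp p"
    unfolding w(2)[symmetric] using p(1) y by (simp add: u_def supp_def m_ac)
  also have "\<dots> = y1"
    using p(2) y by (simp add: mult_supp)
  finally have col1: "y1 = a11 \<otimes> w1 \<otimes> (a21 \<otimes> w2)" ..
  have "v \<otimes> y2 = q \<otimes> supp y2"
    using q(1) y by (simp add: v_def supp_def m_ac)
  also have "\<dots> = q"
    using q by (metis mult_supp)
  finally have vy: "v \<otimes> y2 = q" .
  have "a12 \<otimes> pinv w1 \<otimes> (a22 \<otimes> pinv w2) = q \<otimes> pinv w"
    unfolding q_def w12(5) using a1(1,2) a2(1,2) w12(1,2) by (simp add: pinv_mult m_ac)
  \<comment> \<open>Writing \<open>q\<close> as \<open>v \<otimes> y2\<close> with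
    \<open>v = w \<otimes> supp y2\<close> lets \<open>pinv w\<close> cancel \<open>w\<close> up to
    \<open>supp w\<close>, which \<open>y2\<close> absorbs.\<close>
  also have "\<dots> = (w \<otimes> supp y2) \<otimes> y2 \<otimes> pinv w"
    using vy w(3) v by simp
  also have "\<dots> = (y2 \<otimes> supp y2) \<otimes> supp w"
    using w(1) y by (simp add: supp_def[of w] m_ac)
  also have "\<dots> = y2"
    using w w_le y by (simp add: mult_supp mult_absorb)
  finally have col2: "y2 = a12 \<otimes> pinv w1 \<otimes> (a22 \<otimes> pinv w2)" ..
  show "\<exists>z11\<in>carrier M. \<exists>z12\<in>carrier M. \<exists>z21\<in>carrier M. \<exists>z22\<in>carrier M.
      x1 = z11 \<otimes> z12 \<and> x2 = z21 \<otimes> z22 \<and> y1 = z11 \<otimes> z21 \<and> y2 = z12 \<otimes> z22"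
    by (rule bexI[of _ "a11 \<otimes> w1"], rule bexI[of _ "a12 \<otimes> pinv w1"],
        rule bexI[of _ "a21 \<otimes> w2"], rule bexI[of _ "a22 \<otimes> pinv w2"])
      (intro conjI rows col1 col2 m_closed pinv_closed a1(1,2) a2(1,2) w12(1,2))+
qed

end

end

theorem theorem3p2:
  fixes M (structure)
  assumes "regular_comm_monoid M"
  shows "refinement_monoid M \<longleftrightarrow>
    distributive_semilattice (idempotent_semilattice M) \<and> mayer_vietoris M"
proof -
  interpret regular_comm_monoid M by fact
  show ?thesis
    using mayer_vietoris_if_refinement distributive_idempotents_if_refinement
      refinement_if_mayer_vietoris by blast
qed

end
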